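(* Every class of graphs with linear cop-width has linear flip-width. That is, if $\mathcal{G}$ is a class of graphs for which there is a constant $c$ such that $\operatorname{cw}_r(G)\le c\,r$ for every $r\in\mathbb{N}$ and every $G\in\mathcal{G}$, then there is a constant $c'$ such that $\operatorname{fw}_r(G)\le c'\,r$ for every $r\in\mathbb{N}$ and every $G\in\mathcal{G}$.
   Context: All graphs are finite, simple and undirected; $\mathbb{N}=\{1,2,\dots\}$. A graph class is closed under isomorphism. Cop-width game with radius $r$ and width $k$ on $G$: initially the cops occupy a set $C_0\subseteq V(G)$ with $|C_0|\le k$ and the robber chooses a vertex $x_0$. In each round $i\ge1$, the cops announce a new set $C_i\subseteq V(G)$ with $|C_i|\le k$; the robber, knowing $C_i$, moves from $x_{i-1}$ to a vertex $x_i$ along a path in $G$ of length at most $r$ containing no vertex of $C_{i-1}\cap C_i$. The robber is caught if $x_i\in C_i$. $\operatorname{cw}_r(G)$ is the least $k\in\mathbb{N}$ such that the cops can guarantee capture in finitely many rounds. Flips: for $A,B\subseteq V(G)$, flipping between $A$ and $B$ inverts the adjacency of every pair $a,b$ with $a\in A$, $b\in B$. For a partition $\mathcal{P}$ of $V(G)$, a $\mathcal{P}$-flip of $G$ is a graph obtained from $G$ by a sequence of flips between pairs of parts $A,B\in\mathcal{P}$ (possibly $A=B$); a $k$-flip of $G$ is a $\mathcal{P}$-flip for some partition $\mathcal{P}$ with $|\mathcal{P}|\le k$. Flip-width game with radius $r$ and width $k$ on $G$: $G_0=G$ and the runner chooses a vertex $x_0$. In each round $i\ge1$ the flipper announces a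 $k$-flip $G_i$ of $G$; the runner, knowing $G_i$, moves from $x_{i-1}$ to a vertex $x_i$ along a path of length at most $r$ in $G_{i-1}$. The game ends (flipper wins) when $x_i$ is an isolated vertex of $G_i$. $\operatorname{fw}_r(G)$ is the least $k\in\mathbb{N}$ such that the flipper has a strategy guaranteeing that the game ends after finitely many rounds. *)

theory Defs
  imports Complex_Main "HOL-Library.Disjoint_Sets" "Graph_Theory.Graph_Theory"
begin

text \<open>A finite simple undirected graph is a \<open>pair_graph\<close>: a finite, loop-free, symmetric set of
  arcs without parallel arcs; the edge between \<open>u\<close> and \<open>v\<close> is represented by both arcs \<open>(u, v)\<close>
  and \<open>(v, u)\<close>.\<close>

definition graph_class :: "'a pair_pre_digraph set \<Rightarrow> bool" where
  "graph_class \<G> \<longleftrightarrow>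
     (\<forall>G\<in>\<G>. pair_graph G) \<and>
     (\<forall>G\<in>\<G>. \<forall>H :: 'a pair_pre_digraph. digraph_iso (with_proj G) (with_proj H) \<longrightarrow> H \<in> \<G>)"

definition path_avoiding :: "'a pair_pre_digraph \<Rightarrow> nat \<Rightarrow> 'a set \<Rightarrow> 'a \<Rightarrow> 'a \<Rightarrow> bool" where
  "path_avoiding G r S u v \<longleftrightarrow>
     (\<exists>p. vpath p (with_proj G) \<and> hd p = u \<and> last p = v \<and> vwalk_length p \<le> r \<and> set p \<inter> S = {})"


text \<open>In both games a strategy maps the list \<open>[x\<^sub>0, \<dots>, x\<^sub>i\<^sub>-\<^sub>1]\<close> of positions of the opponent so far
  to the move announced in round \<open>i\<close>. The opponent is represented by the infinite sequence \<open>x\<close> of its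
  positions. Quantifying over infinite sequences loses no play: an opponent that has not lost
  yet can always stay where it is, using the path of length 0. In particular, the robber has no legal
  move only if it already stands on a cop.\<close>

definition cop_strategy :: "'a pair_pre_digraph \<Rightarrow> nat \<Rightarrow> ('a list \<Rightarrow> 'a set) \<Rightarrow> bool" where
  "cop_strategy G k \<sigma> \<longleftrightarrow> (\<forall>h. \<sigma> h \<subseteq> pverts G \<and> card (\<sigma> h) \<le> k)"

definition cop_position :: "('a list \<Rightarrow> 'a set) \<Rightarrow> (nat \<Rightarrow> 'a) \<Rightarrow> nat \<Rightarrow> 'a set" where
  "cop_position \<sigma> x i = \<sigma> (map x [0..<i])"

definition robber_play ::
    "'a pair_pre_digraph \<Rightarrow> nat \<Rightarrow> ('a list \<Rightarrow> 'a set) \<Rightarrow> (nat \<Rightarrow> 'a) \<Rightarrow> bool" where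
  "robber_play G r \<sigma> x \<longleftrightarrow>
     x 0 \<in> pverts G \<and>
     (\<forall>i\<ge>1. path_avoiding G r (cop_position \<sigma> x (i - 1) \<inter> cop_position \<sigma> x i) (x (i - 1)) (x i))"

definition cops_win :: "'a pair_pre_digraph \<Rightarrow> nat \<Rightarrow> nat \<Rightarrow> bool" where
  "cops_win G r k \<longleftrightarrow>
     (\<exists>\<sigma>. cop_strategy G k \<sigma> \<and>
          (\<forall>x. robber_play G r \<sigma> x \<longrightarrow> (\<exists>i. x i \<in> cop_position \<sigma> x i)))"

definition cop_width :: "nat \<Rightarrow> 'a pair_pre_digraph \<Rightarrow> nat" where
  "cop_width r G = (LEAST k. 1 \<le> k \<and> cops_win G r k)"


definition flip :: "'a set \<Rightarrow> 'a set \<Rightarrow> 'a pair_pre_digraph \<Rightarrow> 'a pair_pre_digraph" where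
  "flip A B G = G\<lparr>parcs := {(u, v).
     ((u, v) \<in> parcs G) \<noteq> (u \<noteq> v \<and> (u \<in> A \<and> v \<in> B \<or> u \<in> B \<and> v \<in> A))}\<rparr>"

inductive partition_flip ::
    "'a set set \<Rightarrow> 'a pair_pre_digraph \<Rightarrow> 'a pair_pre_digraph \<Rightarrow> bool"
  for P :: "'a set set" and G :: "'a pair_pre_digraph" where
  refl: "partition_flip P G G"
| step: "partition_flip P G H \<Longrightarrow> A \<in> P \<Longrightarrow> B \<in> P \<Longrightarrow> partition_flip P G (flip A B H)"

definition k_flip :: "nat \<Rightarrow> 'a pair_pre_digraph \<Rightarrow> 'a pair_pre_digraph \<Rightarrow> bool" where
  "k_flip k G H \<longleftrightarrow> (\<exists>P. partition_on (pverts G) P \<and> card P \<le> k \<and> partition_flip P G H)"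

definition isolated :: "'a pair_pre_digraph \<Rightarrow> 'a \<Rightarrow> bool" where
  "isolated G v \<longleftrightarrow> v \<in> pverts G \<and> (\<forall>u. (v, u) \<notin> parcs G \<and> (u, v) \<notin> parcs G)"

definition flipper_strategy ::
    "'a pair_pre_digraph \<Rightarrow> nat \<Rightarrow> ('a list \<Rightarrow> 'a pair_pre_digraph) \<Rightarrow> bool" where
  "flipper_strategy G k \<sigma> \<longleftrightarrow> (\<forall>h. k_flip k G (\<sigma> h))"

definition flipped_graph ::
    "'a pair_pre_digraph \<Rightarrow> ('a list \<Rightarrow> 'a pair_pre_digraph) \<Rightarrow> (nat \<Rightarrow> 'a) \<Rightarrow> nat \<Rightarrow>
      'a pair_pre_digraph" where
  "flipped_graph G \<sigma> x i = (if i = 0 then G else \<sigma> (map x [0..<i]))"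

definition runner_play ::
    "'a pair_pre_digraph \<Rightarrow> nat \<Rightarrow> ('a list \<Rightarrow> 'a pair_pre_digraph) \<Rightarrow> (nat \<Rightarrow> 'a) \<Rightarrow> bool" where
  "runner_play G r \<sigma> x \<longleftrightarrow>
     x 0 \<in> pverts G \<and>
     (\<forall>i\<ge>1. path_avoiding (flipped_graph G \<sigma> x (i - 1)) r {} (x (i - 1)) (x i))"

definition flipper_wins :: "'a pair_pre_digraph \<Rightarrow> nat \<Rightarrow> nat \<Rightarrow> bool" where
  "flipper_wins G r k \<longleftrightarrow>
     (\<exists>\<sigma>. flipper_strategy G k \<sigma> \<and>
          (\<forall>x. runner_play G r \<sigma> x \<longrightarrow> (\<exists>i. isolated (flipped_graph G \<sigma> x i) (x i))))"

definition flip_width :: "nat \<Rightarrow> 'a pair_pre_digraph \<Rightarrow> nat" where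
  "flip_width r G = (LEAST k. 1 \<le> k \<and> flipper_wins G r k)"


definition linear_cop_width :: "'a pair_pre_digraph set \<Rightarrow> bool" where
  "linear_cop_width \<G> \<longleftrightarrow>
     (\<exists>c::real. \<forall>r\<ge>1. \<forall>G\<in>\<G>. real (cop_width r G) \<le> c * real r)"

definition linear_flip_width :: "'a pair_pre_digraph set \<Rightarrow> bool" where
  "linear_flip_width \<G> \<longleftrightarrow>
     (\<exists>c::real. \<forall>r\<ge>1. \<forall>G\<in>\<G>. real (flip_width r G) \<le> c * real r)"

end

theory Submission
  imports Defs
begin

text \<open>The flipper imitates the cops: from a cop position \<open>C\<close> it isolates all vertices of \<open>C\<close>, flipping
  along the partition into the singletons of \<open>C\<close> and the classes of vertices outside \<open>C\<close> with
  the same neighbourhood in \<open>C\<close>. It remains to see that the number of these neighbourhoods is linear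
  in \<open>|C|\<close>. Let a maximal number of vertices outside \<open>C\<close> serve as subdivision vertices of distinct
  edges of a graph \<open>M\<close> on \<open>C\<close>; by maximality, the neighbourhood of every other vertex is a clique
  of \<open>M\<close>. As \<open>G\<close> contains a 1-subdivision of \<open>M\<close>, the robber of radius 2 can exploit any subgraph
  of \<open>M\<close> of minimum degree greater than \<open>d = cw\<^sub>2(G)\<close>, so \<open>M\<close> is \<open>d\<close>-degenerate and has at most
  \<open>2\<^sup>d |C| + 1\<close> cliques, edges included.\<close>

section \<open>Cliques in degenerate graphs\<close>

definition nbhd :: "'a set set \<Rightarrow> 'a \<Rightarrow> 'a set" where
  "nbhd M v = {w. w \<noteq> v \<and> {v, w} \<in> M}"

definition cliques :: "'a set set \<Rightarrow> 'a set \<Rightarrow> 'a set set" where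
  "cliques M A = {X. X \<subseteq> A \<and> (\<forall>v\<in>X. X - {v} \<subseteq> nbhd M v)}"

definition degenerate :: "nat \<Rightarrow> 'a set set \<Rightarrow> 'a set \<Rightarrow> bool" where
  "degenerate d M A \<longleftrightarrow> (\<forall>A'\<subseteq>A. A' \<noteq> {} \<longrightarrow> (\<exists>v\<in>A'. card (A' \<inter> nbhd M v) \<le> d))"

lemma degenerate_subset: "degenerate d M A \<Longrightarrow> A' \<subseteq> A \<Longrightarrow> degenerate d M A'"
  unfolding degenerate_def by (meson subset_trans)

lemma finite_cliques: "finite A \<Longrightarrow> finite (cliques M A)"
  by (simp add: cliques_def)

lemma cliques_insert_subset:
  "cliques M (insert v A) \<subseteq> cliques M A \<union> insert v ` Pow (A \<inter> nbhd M v)"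
proof
  fix X assume X: "X \<in> cliques M (insert v A)"
  show "X \<in> cliques M A \<union> insert v ` Pow (A \<inter> nbhd M v)"
  proof (cases "v \<in> X")
    case True
    then have "X = insert v (X - {v})" "X - {v} \<in> Pow (A \<inter> nbhd M v)"
      using X by (auto simp: cliques_def)
    then show ?thesis by blast
  next
    case False
    then show ?thesis using X by (auto simp: cliques_def)
  qed
qed

lemma card_cliques_insert_le:
  assumes "finite A"
  shows "card (cliques M (insert v A)) \<le> card (cliques M A) + 2 ^ card (A \<inter> nbhd M v)"
proof -
  have "card (cliques M (insert v A)) \<le> card (cliques M A \<union> insert v ` Pow (A \<inter> nbhd M v))"
    using assms by (intro card_mono cliques_insert_subset) (simp add: finite_cliques)
  also have "\<dots> \<le> card (cliques M A) + card (insert v ` Pow (A \<inter> nbhd M v))"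
    by (rule card_Un_le)
  also have "card (insert v ` Pow (A \<inter> nbhd M v)) \<le> 2 ^ card (A \<inter> nbhd M v)"
    using assms by (metis card_Pow card_image_le finite_Int finite_Pow_iff)
  finally show ?thesis by simp
qed

lemma card_cliques_le:
  assumes "finite A" "degenerate d M A"
  shows "card (cliques M A) \<le> 2 ^ d * card A + 1"
  using assms
proof (induction A rule: finite_psubset_induct)
  case (psubset A)
  show ?case
  proof (cases "A = {}")
    case True
    then have "cliques M A = {{}}" by (auto simp: cliques_def)
    then show ?thesis by simp
  next
    case False
    with psubset.prems obtain v where v: "v \<in> A" and deg_v: "card (A \<inter> nbhd M v) \<le> d"
      unfolding degenerate_def by blast
    have "A \<inter> nbhd M v = (A - {v}) \<inter> nbhd M v" by (auto simp: nbhd_def)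
    then have "card (cliques M A) \<le> card (cliques M (A - {v})) + 2 ^ card (A \<inter> nbhd M v)"
      using card_cliques_insert_le[of "A - {v}" M v] psubset.hyps v by (simp add: insert_absorb)
    also have "\<dots> \<le> (2 ^ d * card (A - {v}) + 1) + 2 ^ d"
      using v deg_v psubset.prems
      by (intro add_mono psubset.IH degenerate_subset[OF psubset.prems] power_increasing) auto
    also have "\<dots> = 2 ^ d * card A + 1"
      using card_Suc_Diff1[OF psubset.hyps v] by (metis add.assoc add.commute mult_Suc_right)
    finally show ?thesis .
  qed
qed

section \<open>Subdivisions\<close>

text \<open>In the bipartite graph between \<open>A\<close> and \<open>B\<close> with neighbourhoods \<open>N\<close>, the vertex \<open>s e\<close> subdivides
  the edge \<open>e\<close> of the graph \<open>M\<close> on \<open>A\<close>.\<close>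

definition one_subdivision ::
    "'a set \<Rightarrow> 'b set \<Rightarrow> ('b \<Rightarrow> 'a set) \<Rightarrow> 'a set set \<Rightarrow> ('a set \<Rightarrow> 'b) \<Rightarrow> bool" where
  "one_subdivision A B N M s \<longleftrightarrow>
     inj_on s M \<and> s ` M \<subseteq> B \<and> (\<forall>e\<in>M. card e = 2 \<and> e \<subseteq> A \<inter> N (s e))"

lemma one_subdivision_insert:
  assumes "one_subdivision A B N M s" "b \<in> B - s ` M" "{u, w} \<subseteq> A \<inter> N b" "u \<noteq> w" "{u, w} \<notin> M"
  shows "one_subdivision A B N (insert {u, w} M) (s({u, w} := b))"
  using assms unfolding one_subdivision_def by (auto simp: inj_on_def fun_upd_def)

lemma
  assumes "one_subdivision A B N M s" "finite B"
  shows finite_edges: "finite M" and card_edges_le: "card M \<le> card B"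
proof -
  have "inj_on s M" "s ` M \<subseteq> B" using assms(1) by (auto simp: one_subdivision_def)
  then show "finite M" "card M \<le> card B"
    using assms(2) by (auto intro: inj_on_finite card_inj_on_le)
qed

lemma edges_subset_cliques:
  assumes "one_subdivision A B N M s"
  shows "M \<subseteq> cliques M A"
  using assms by (fastforce simp: one_subdivision_def cliques_def nbhd_def card_2_iff insert_commute)

lemma ex_one_subdivision_with_cliques:
  assumes "finite B"
  obtains M s where "one_subdivision A B N M s"
    "\<And>b. b \<in> B - s ` M \<Longrightarrow> A \<inter> N b \<in> cliques M A"
proof -
  let ?subdiv = "\<lambda>M. \<exists>s. one_subdivision A B N M s"
  have "?subdiv {}" by (simp add: one_subdivision_def)
  moreover have "\<forall>M. ?subdiv M \<longrightarrow> card M < Suc (card B)"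
    using card_edges_le[OF _ assms] by (auto simp: less_Suc_eq_le)
  ultimately obtain M s where subdiv: "one_subdivision A B N M s"
    and maximal: "\<And>M' s'. one_subdivision A B N M' s' \<Longrightarrow> card M' \<le> card M"
    using ex_has_greatest_nat[of ?subdiv "{}" card "Suc (card B)"] by blast
  have "A \<inter> N b \<in> cliques M A" if b: "b \<in> B - s ` M" for b
  proof -
    have "{u, w} \<in> M" if "{u, w} \<subseteq> A \<inter> N b" "u \<noteq> w" for u w
    proof (rule ccontr)
      assume new: "{u, w} \<notin> M"
      have "card (insert {u, w} M) \<le> card M"
        using one_subdivision_insert[OF subdiv b that new] by (rule maximal)
      then show False using new finite_edges[OF subdiv assms] by simp
    qed
    then show ?thesis by (auto simp: cliques_def nbhd_def)
  qed
  with subdiv show thesis by (rule that)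
qed

lemma card_neighbourhoods_le_if_degenerate:
  assumes "finite A" "finite B" and N_subset: "\<And>b. b \<in> B \<Longrightarrow> N b \<subseteq> A"
    and degenerate: "\<And>M s. one_subdivision A B N M s \<Longrightarrow> degenerate d M A"
  shows "card (N ` B) \<le> 2 * (2 ^ d * card A + 1)"
proof -
  obtain M s where subdiv: "one_subdivision A B N M s"
    and unused: "\<And>b. b \<in> B - s ` M \<Longrightarrow> A \<inter> N b \<in> cliques M A"
    using ex_one_subdivision_with_cliques[OF assms(2)] by blast
  have finite: "finite M" "finite (cliques M A)"
    using finite_edges[OF subdiv assms(2)] finite_cliques[OF assms(1)] by auto
  have "N b \<in> cliques M A" if "b \<in> B - s ` M" for b
    using unused[OF that] N_subset[of b] that by (simp add: Int_absorb1)
  then have "N ` B \<subseteq> (\<lambda>e. N (s e)) ` M \<union> cliques M A" by auto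
  then have "card (N ` B) \<le> card ((\<lambda>e. N (s e)) ` M \<union> cliques M A)"
    using finite by (intro card_mono) auto
  also have "\<dots> \<le> card M + card (cliques M A)"
    by (intro card_Un_le[THEN order_trans] add_mono card_image_le finite order_refl)
  also have "\<dots> \<le> 2 * card (cliques M A)"
    using card_mono[OF finite(2) edges_subset_cliques[OF subdiv]] by simp
  also have "\<dots> \<le> 2 * (2 ^ d * card A + 1)"
    using card_cliques_le[OF assms(1) degenerate[OF subdiv]] by (rule mult_le_mono2)
  finally show ?thesis .
qed

lemma ex_unblocked_subdivided_edge:
  assumes subdiv: "one_subdivision A B N M s" and disjoint: "A \<inter> B = {}"
    and W_subset: "W \<subseteq> nbhd M v" and "finite T" "v \<in> T" "card T \<le> card W"
  shows "\<exists>w\<in>W - T. s {v, w} \<notin> T"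
proof (rule ccontr)
  assume blocked: "\<not> ?thesis"
  define blocker where "blocker w = (if w \<in> T then w else s {v, w})" for w
  have edge: "{v, w} \<in> M" "v \<noteq> w" if "w \<in> W" for w
    using that W_subset by (auto simp: nbhd_def)
  have ends_in_A: "v \<in> A" "w \<in> A" if "w \<in> W" for w
    using edge[OF that] subdiv by (auto simp: one_subdivision_def)
  have s_notin_A: "s {v, w} \<notin> A" if "w \<in> W" for w
    using edge[OF that] subdiv disjoint by (auto simp: one_subdivision_def)
  have s_inj: "w = w'" if "w \<in> W" "w' \<in> W" "s {v, w} = s {v, w'}" for w w'
    using inj_onD[of s M "{v, w}" "{v, w'}"] that edge subdiv
    by (auto simp: one_subdivision_def doubleton_eq_iff)
  have "inj_on blocker W"
    by (rule inj_onI) (metis blocker_def ends_in_A(2) s_inj s_notin_A)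
  moreover have "blocker w \<in> T - {v}" if "w \<in> W" for w
    using blocked that edge(2)[OF that] ends_in_A(1)[OF that] s_notin_A[OF that]
    by (auto simp: blocker_def)
  then have "blocker ` W \<subseteq> T - {v}" by blast
  ultimately have "card W \<le> card (T - {v})"
    using \<open>finite T\<close> by (intro card_inj_on_le) auto
  also have "\<dots> < card T" using \<open>finite T\<close> \<open>v \<in> T\<close> by (rule card_Diff1_less)
  finally show False using \<open>card T \<le> card W\<close> by simp
qed

section \<open>The robber on a subdivision\<close>

lemma path_avoiding_mono: "path_avoiding G r S u v \<Longrightarrow> S' \<subseteq> S \<Longrightarrow> path_avoiding G r S' u v"
  unfolding path_avoiding_def by blast

lemma path_avoiding_refl: "v \<in> pverts G - S \<Longrightarrow> path_avoiding G r S v v"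
  unfolding path_avoiding_def vpath_def vwalk_def by (intro exI[of _ "[v]"]) auto

lemma path_avoiding_in_pverts: "path_avoiding G r S u v \<Longrightarrow> v \<in> pverts G"
  unfolding path_avoiding_def vpath_def vwalk_def using last_in_set by fastforce

lemma (in pair_wf_digraph) path_avoiding_two_arcs:
  assumes "(u, b) \<in> parcs G" "(b, v) \<in> parcs G" "distinct [u, b, v]" "{u, b, v} \<inter> S = {}" "2 \<le> r"
  shows "path_avoiding G r S u v"
  unfolding path_avoiding_def vpath_def vwalk_def
  using assms in_arcsD1 in_arcsD2 by (intro exI[of _ "[u, b, v]"]) auto

lemma ex_sequence_if_prefixes_extend:
  assumes "P []" and extend: "\<And>h. P h \<Longrightarrow> \<exists>y. P (h @ [y])"
  obtains x :: "nat \<Rightarrow> 'a" where "\<And>n. P (map x [0..<n])"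
proof -
  have "\<exists>h. \<forall>n. (P (h n) \<and> (n = 0 \<longrightarrow> h n = [])) \<and> (\<exists>y. h (Suc n) = h n @ [y])"
    using assms by (intro dependent_nat_choice) auto
  then obtain h where P_h: "\<And>n. P (h n)" and h_0: "h 0 = []"
    and h_Suc: "\<And>n. \<exists>y. h (Suc n) = h n @ [y]" by blast
  define x where "x n = last (h (Suc n))" for n
  have "map x [0..<n] = h n" for n
  proof (induction n)
    case (Suc n)
    then show ?case using h_Suc[of n] by (auto simp: x_def)
  qed (simp add: h_0)
  then show thesis using P_h that by metis
qed

lemma ex_evading_robber_play:
  assumes A_subset: "A \<subseteq> pverts G" and start: "\<not> A \<subseteq> \<sigma> []"
    and step: "\<And>v h h'. v \<in> A - \<sigma> h \<Longrightarrow> \<exists>y\<in>A - \<sigma> h'. path_avoiding G r (\<sigma> h \<inter> \<sigma> h') v y"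
  shows "\<exists>x. robber_play G r \<sigma> x \<and> (\<forall>i. x i \<notin> cop_position \<sigma> x i)"
proof -
  define evading where "evading h \<longleftrightarrow> (h \<noteq> [] \<longrightarrow> last h \<in> A - \<sigma> (butlast h)) \<and>
    (2 \<le> length h \<longrightarrow> path_avoiding G r (\<sigma> (butlast (butlast h)) \<inter> \<sigma> (butlast h))
      (last (butlast h)) (last h))" for h
  have "\<exists>y. evading (h @ [y])" if "evading h" for h
  proof (cases "h = []")
    case True
    then show ?thesis using start by (auto simp: evading_def)
  next
    case False
    then have "last h \<in> A - \<sigma> (butlast h)" using that by (simp add: evading_def)
    from step[OF this, of h] show ?thesis using False by (auto simp: evading_def)
  qed
  moreover have "evading []" by (simp add: evading_def)
  ultimately obtain x where evading_x: "\<And>n. evading (map x [0..<n])"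
    using ex_sequence_if_prefixes_extend[of evading] by blast
  have evades: "x i \<in> A - cop_position \<sigma> x i" for i
    using evading_x[of "Suc i"] by (simp add: evading_def cop_position_def)
  have "path_avoiding G r (cop_position \<sigma> x (i - 1) \<inter> cop_position \<sigma> x i) (x (i - 1)) (x i)"
    if "1 \<le> i" for i
    using that evading_x[of "Suc i"]
    by (cases i) (simp_all add: evading_def cop_position_def butlast_append)
  then have "robber_play G r \<sigma> x"
    using evades A_subset unfolding robber_play_def by blast
  then show ?thesis using evades by blast
qed

definition trace :: "'a pair_pre_digraph \<Rightarrow> 'a set \<Rightarrow> 'a \<Rightarrow> 'a set" where
  "trace G C v = {u \<in> C. (v, u) \<in> parcs G}"

context pair_graph
begin

text \<open>A robber on a branch vertex leaves it only if a cop is about to land there; the remaining cops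
  are too few to block all of the subdivided edges at this vertex.\<close>

lemma robber_step_on_subdivision:
  assumes C_subset: "C \<subseteq> pverts G" and "2 \<le> r"
    and subdiv: "one_subdivision C (pverts G - C) (trace G C) M s"
    and A_subset: "A \<subseteq> C" and v_free: "v \<in> A - S"
    and "finite T" and card_T: "card T \<le> card (A \<inter> nbhd M v)"
  shows "\<exists>w\<in>A - T. path_avoiding G r (S \<inter> T) v w"
proof (cases "v \<in> T")
  case True
  obtain w where w: "w \<in> A \<inter> nbhd M v - T" "s {v, w} \<notin> T"
    using ex_unblocked_subdivided_edge[OF subdiv _ _ \<open>finite T\<close> True card_T] by blast
  then have "{v, w} \<in> M" by (simp add: nbhd_def)
  then have "s {v, w} \<notin> C" "{v, w} \<subseteq> trace G C (s {v, w})"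
    using subdiv by (auto simp: one_subdivision_def)
  moreover from this have "(v, s {v, w}) \<in> parcs G" "(s {v, w}, w) \<in> parcs G"
    by (auto simp: trace_def intro: arcs_symmetric)
  ultimately have "path_avoiding G r (S \<inter> T) v w"
    using w v_free A_subset \<open>2 \<le> r\<close> by (intro path_avoiding_two_arcs) (auto simp: nbhd_def)
  with w show ?thesis by blast
next
  case False
  then have "path_avoiding G r (S \<inter> T) v v"
    using C_subset v_free A_subset by (intro path_avoiding_refl) auto
  with v_free False show ?thesis by blast
qed

lemma degenerate_if_cops_win:
  assumes "cops_win G r d" "2 \<le> r" "C \<subseteq> pverts G"
    and subdiv: "one_subdivision C (pverts G - C) (trace G C) M s"
  shows "degenerate d M C"
proof (rule ccontr)
  assume "\<not> degenerate d M C"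
  then obtain A where A_subset: "A \<subseteq> C" and "A \<noteq> {}"
    and degree: "\<And>v. v \<in> A \<Longrightarrow> d < card (A \<inter> nbhd M v)"
    unfolding degenerate_def by (meson linorder_not_less)
  obtain \<sigma> where \<sigma>: "cop_strategy G d \<sigma>"
    and caught: "\<And>x. robber_play G r \<sigma> x \<Longrightarrow> \<exists>i. x i \<in> cop_position \<sigma> x i"
    using assms(1) unfolding cops_win_def by blast
  have cops: "finite (\<sigma> h)" "card (\<sigma> h) \<le> d" for h
    using \<sigma> finite_subset[OF _ pair_finite_verts] by (auto simp: cop_strategy_def)
  have "A \<subseteq> pverts G" using A_subset assms(3) by blast
  moreover have "\<not> A \<subseteq> \<sigma> []"
  proof
    assume "A \<subseteq> \<sigma> []"
    obtain v where "v \<in> A" using \<open>A \<noteq> {}\<close> by blast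
    have "card (A \<inter> nbhd M v) \<le> card (\<sigma> [])"
      using \<open>A \<subseteq> \<sigma> []\<close> cops(1) by (intro card_mono) auto
    with degree[OF \<open>v \<in> A\<close>] cops(2)[of "[]"] show False by simp
  qed
  moreover have "\<exists>y\<in>A - \<sigma> h'. path_avoiding G r (\<sigma> h \<inter> \<sigma> h') v y"
    if v_free: "v \<in> A - \<sigma> h" for v h h'
  proof -
    have "card (\<sigma> h') \<le> card (A \<inter> nbhd M v)" using cops(2)[of h'] degree[of v] v_free by simp
    with robber_step_on_subdivision[OF assms(3,2) subdiv A_subset v_free cops(1)] show ?thesis .
  qed
  ultimately have "\<exists>x. robber_play G r \<sigma> x \<and> (\<forall>i. x i \<notin> cop_position \<sigma> x i)"
    by (rule ex_evading_robber_play)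
  then show False using caught by blast
qed

lemma card_traces_le:
  assumes "cops_win G r d" "2 \<le> r" "C \<subseteq> pverts G"
  shows "card (trace G C ` (pverts G - C)) \<le> 2 * (2 ^ d * card C + 1)"
proof (rule card_neighbourhoods_le_if_degenerate)
  show "finite C" "finite (pverts G - C)"
    using assms(3) pair_finite_verts by (auto intro: finite_subset)
  show "trace G C b \<subseteq> C" for b by (auto simp: trace_def)
qed (rule degenerate_if_cops_win[OF assms])

end

section \<open>Isolating vertices by flips\<close>

definition flip_pairs :: "'a rel \<Rightarrow> 'a pair_pre_digraph \<Rightarrow> 'a pair_pre_digraph" where
  "flip_pairs R G = G\<lparr>parcs := sym_diff (parcs G) R\<rparr>"

definition homogeneous :: "'a set set \<Rightarrow> 'a rel \<Rightarrow> bool" where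
  "homogeneous P R \<longleftrightarrow> (\<forall>A\<in>P. \<forall>B\<in>P. A \<times> B - Id \<subseteq> R \<or> A \<times> B \<inter> R = {})"

lemma flip_pairs_empty: "flip_pairs {} G = G"
  by (simp add: flip_pairs_def)

lemma flip_eq_flip_pairs: "flip A B G = flip_pairs (A \<times> B \<union> B \<times> A - Id) G"
  by (rule pair_pre_digraph.equality) (auto simp: flip_def flip_pairs_def)

lemma flip_pairs_flip_pairs:
  "R \<inter> S = {} \<Longrightarrow> flip_pairs R (flip_pairs S G) = flip_pairs (R \<union> S) G"
  by (rule pair_pre_digraph.equality) (auto simp: flip_pairs_def)

lemma homogeneous_Diff_flip:
  assumes "homogeneous P R" "disjoint P" "irrefl R" "A \<in> P" "B \<in> P"
  shows "homogeneous P (R - (A \<times> B \<union> B \<times> A - Id))" (is "homogeneous P ?R'")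
  unfolding homogeneous_def
proof (intro ballI)
  fix X Y assume XY: "X \<in> P" "Y \<in> P"
  show "X \<times> Y - Id \<subseteq> ?R' \<or> X \<times> Y \<inter> ?R' = {}"
  proof (cases "(X, Y) \<in> {(A, B), (B, A)}")
    case True
    then have "X \<times> Y \<inter> ?R' = {}" using \<open>irrefl R\<close> by (auto simp: irrefl_def)
    then show ?thesis ..
  next
    case False
    then have "X \<times> Y \<inter> (A \<times> B \<union> B \<times> A) = {}"
      using XY assms(2,4,5) by (auto dest: disjointD)
    then show ?thesis using XY assms(1) unfolding homogeneous_def by blast
  qed
qed

lemma partition_flip_flip_pairs:
  assumes "finite R" "disjoint P" "R \<subseteq> \<Union>P \<times> \<Union>P" "sym R" "irrefl R" "homogeneous P R"
  shows "partition_flip P G (flip_pairs R G)"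
  using assms(1,3-6)
proof (induction R rule: finite_psubset_induct)
  case (psubset R)
  show ?case
  proof (cases "R = {}")
    case True
    then show ?thesis by (simp add: flip_pairs_empty partition_flip.refl)
  next
    case False
    then obtain u v where "(u, v) \<in> R" by fast
    then obtain A B where AB: "A \<in> P" "B \<in> P" "u \<in> A" "v \<in> B" using psubset.prems(1) by blast
    define E where "E = A \<times> B \<union> B \<times> A - Id"
    have "A \<times> B - Id \<subseteq> R"
      using psubset.prems(4) AB \<open>(u, v) \<in> R\<close> unfolding homogeneous_def by blast
    then have "E \<subseteq> R" using psubset.prems(2) by (auto simp: E_def dest: symD)
    moreover have "(u, v) \<in> E"
      using AB \<open>(u, v) \<in> R\<close> psubset.prems(3) by (auto simp: E_def irrefl_def)
    ultimately have "R - E \<subset> R" by blast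
    moreover have "R - E \<subseteq> \<Union>P \<times> \<Union>P" "sym (R - E)" "irrefl (R - E)" "homogeneous P (R - E)"
      using psubset.prems AB assms(2) homogeneous_Diff_flip[of P R A B]
      by (auto simp: E_def sym_def irrefl_def)
    ultimately have "partition_flip P G (flip A B (flip_pairs (R - E) G))"
      using AB by (intro partition_flip.step psubset.IH)
    moreover have "flip A B (flip_pairs (R - E) G) = flip_pairs R G"
      using \<open>E \<subseteq> R\<close> by (simp add: flip_eq_flip_pairs flip_pairs_flip_pairs Un_absorb1 flip: E_def)
    ultimately show ?thesis by simp
  qed
qed

definition incident_arcs :: "'a set \<Rightarrow> 'a pair_pre_digraph \<Rightarrow> 'a rel" where
  "incident_arcs C G = {(u, v) \<in> parcs G. u \<in> C \<or> v \<in> C}"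

definition isolate :: "'a set \<Rightarrow> 'a pair_pre_digraph \<Rightarrow> 'a pair_pre_digraph" where
  "isolate C G = G\<lparr>parcs := parcs G - incident_arcs C G\<rparr>"

definition trace_partition :: "'a pair_pre_digraph \<Rightarrow> 'a set \<Rightarrow> 'a set set" where
  "trace_partition G C = (\<lambda>v. {v}) ` C \<union>
     (\<lambda>N. {v \<in> pverts G - C. trace G C v = N}) ` trace G C ` (pverts G - C)"

lemma isolated_isolate: "v \<in> pverts G \<Longrightarrow> v \<in> C \<Longrightarrow> isolated (isolate C G) v"
  by (auto simp: isolated_def isolate_def incident_arcs_def)

lemma isolate_eq_flip_pairs: "isolate C G = flip_pairs (incident_arcs C G) G"
  by (rule pair_pre_digraph.equality) (auto simp: isolate_def flip_pairs_def incident_arcs_def)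

lemma partition_on_trace_partition:
  "C \<subseteq> pverts G \<Longrightarrow> partition_on (pverts G) (trace_partition G C)"
  by (intro partition_onI) (auto simp: trace_partition_def disjnt_def)

lemma card_trace_partition_le:
  assumes "finite (pverts G)" "C \<subseteq> pverts G"
  shows "card (trace_partition G C) \<le> card C + card (trace G C ` (pverts G - C))"
  using assms unfolding trace_partition_def
  by (intro card_Un_le[THEN order_trans] add_mono card_image_le) (auto intro: finite_subset)

context pair_graph
begin

lemma homogeneous_trace_partition:
  "homogeneous (trace_partition G C) (incident_arcs C G)"
  unfolding homogeneous_def
proof (intro ballI)
  let ?R = "incident_arcs C G"
  fix X Y assume parts: "X \<in> trace_partition G C" "Y \<in> trace_partition G C"
  have same_part: "v \<in> C \<and> v' = v \<or> v \<notin> C \<and> v' \<notin> C \<and> trace G C v = trace G C v'"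
    if "Z \<in> trace_partition G C" "v \<in> Z" "v' \<in> Z" for Z v v'
    using that by (auto simp: trace_partition_def)
  have same_trace: "(v', u) \<in> parcs G"
    if "(v, u) \<in> parcs G" "u \<in> C" "trace G C v = trace G C v'" for u v v'
    using that by (auto simp: trace_def)
  have "(u', v') \<in> ?R" if "(u, v) \<in> ?R" "u \<in> X" "u' \<in> X" "v \<in> Y" "v' \<in> Y" for u u' v v'
    using same_part[OF parts(1) that(2,3)] same_part[OF parts(2) that(4,5)] that(1)
      same_trace[of v u v'] same_trace[of u v u'] arcs_symmetric[of u v] arcs_symmetric[of v' u]
    by (auto simp: incident_arcs_def)
  then show "X \<times> Y - Id \<subseteq> ?R \<or> X \<times> Y \<inter> ?R = {}" by blast
qed

lemma partition_flip_isolate: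
  assumes "C \<subseteq> pverts G"
  shows "partition_flip (trace_partition G C) G (isolate C G)"
  unfolding isolate_eq_flip_pairs
proof (rule partition_flip_flip_pairs)
  have partition: "partition_on (pverts G) (trace_partition G C)"
    using assms by (rule partition_on_trace_partition)
  then show "disjoint (trace_partition G C)" by (rule partition_onD2)
  show "incident_arcs C G \<subseteq> \<Union> (trace_partition G C) \<times> \<Union> (trace_partition G C)"
    using in_arcsD1 in_arcsD2
    by (auto simp: incident_arcs_def simp flip: partition_onD1[OF partition])
  show "finite (incident_arcs C G)"
    using pair_finite_arcs by (rule finite_subset[rotated]) (auto simp: incident_arcs_def)
  show "sym (incident_arcs C G)" by (auto simp: incident_arcs_def intro!: symI arcs_symmetric)
  show "irrefl (incident_arcs C G)" using no_loops' by (auto simp: incident_arcs_def irrefl_def)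
qed (rule homogeneous_trace_partition)

lemma k_flip_isolate:
  assumes "cops_win G r d" "2 \<le> r" and C_subset: "C \<subseteq> pverts G"
    and width: "card C + 2 * (2 ^ d * card C + 1) \<le> m"
  shows "k_flip m G (isolate C G)"
proof -
  have "card (trace_partition G C) \<le> m"
    using card_trace_partition_le[OF pair_finite_verts C_subset] card_traces_le[OF assms(1-3)] width
    by linarith
  then show ?thesis
    unfolding k_flip_def
    using partition_on_trace_partition[OF C_subset] partition_flip_isolate[OF C_subset] by blast
qed

end

section \<open>From cops to flips\<close>

lemma vwalk_avoids_isolated:
  assumes "set (vwalk_arcs p) \<subseteq> parcs (isolate C G)" "p \<noteq> []" "hd p \<notin> C"
  shows "set p \<inter> C = {}"
  using assms by (induction p rule: vwalk_arcs.induct) (auto simp: isolate_def incident_arcs_def)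

lemma path_avoiding_if_path_in_isolate:
  assumes "path_avoiding (isolate C G) r S u v" "u \<notin> C"
  shows "path_avoiding G r C u v"
proof -
  obtain p where p: "vpath p (with_proj (isolate C G))" "hd p = u" "last p = v" "vwalk_length p \<le> r"
    using assms(1) unfolding path_avoiding_def by blast
  have "set p \<inter> C = {}"
    using p assms(2) by (intro vwalk_avoids_isolated) (auto simp: vpath_def vwalk_def)
  moreover have "vpath p (with_proj G)"
    using p(1) by (auto simp: vpath_def vwalk_def isolate_def)
  ultimately show ?thesis using p unfolding path_avoiding_def by blast
qed

text \<open>The flipper isolates the cops one round late, because the first runner move takes place in \<open>G\<close>
  itself; the runner's vertex \<open>x\<^sub>1\<close> serves as the initial robber position.\<close>

definition isolating_strategy ::
    "'a pair_pre_digraph \<Rightarrow> ('a list \<Rightarrow> 'a set) \<Rightarrow> 'a list \<Rightarrow> 'a pair_pre_digraph" where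
  "isolating_strategy G \<sigma> h = isolate (\<sigma> (tl h)) G"

lemma flipped_graph_isolating_strategy:
  "flipped_graph G (isolating_strategy G \<sigma>) x (Suc n) = isolate (cop_position \<sigma> (x \<circ> Suc) n) G"
  unfolding flipped_graph_def isolating_strategy_def cop_position_def
  by (simp add: map_upt_Suc comp_def del: upt_Suc)

lemma robber_play_if_runner_play:
  assumes play: "runner_play G r (isolating_strategy G \<sigma>) x"
    and free: "\<And>n. x (Suc n) \<notin> cop_position \<sigma> (x \<circ> Suc) n"
  shows "robber_play G r \<sigma> (x \<circ> Suc)"
proof -
  let ?C = "cop_position \<sigma> (x \<circ> Suc)"
  have move: "path_avoiding (flipped_graph G (isolating_strategy G \<sigma>) x n) r {} (x n) (x (Suc n))"
    for n
    using play by (metis runner_play_def diff_Suc_1 le_add1 plus_1_eq_Suc)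
  have "path_avoiding G r (?C n) (x (Suc n)) (x (Suc (Suc n)))" for n
    using move[of "Suc n"] free[of n]
    by (auto simp: flipped_graph_isolating_strategy intro: path_avoiding_if_path_in_isolate)
  then have "path_avoiding G r (?C n \<inter> ?C (Suc n)) (x (Suc n)) (x (Suc (Suc n)))" for n
    by (rule path_avoiding_mono) simp
  moreover have "x (Suc 0) \<in> pverts G"
    using path_avoiding_in_pverts[OF move[of 0]] by (simp add: flipped_graph_def)
  ultimately show ?thesis
    unfolding robber_play_def by (auto simp: Suc_le_eq gr0_conv_Suc)
qed

lemma flipper_wins_if_k_flip_isolate:
  assumes "cops_win G r k"
    and k_flip: "\<And>C. C \<subseteq> pverts G \<Longrightarrow> card C \<le> k \<Longrightarrow> k_flip m G (isolate C G)"
  shows "flipper_wins G r m"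
proof -
  obtain \<sigma> where \<sigma>: "cop_strategy G k \<sigma>"
    and caught: "\<And>x. robber_play G r \<sigma> x \<Longrightarrow> \<exists>i. x i \<in> cop_position \<sigma> x i"
    using assms(1) unfolding cops_win_def by blast
  let ?\<tau> = "isolating_strategy G \<sigma>"
  have "flipper_strategy G m ?\<tau>"
    using \<sigma> k_flip by (simp add: flipper_strategy_def cop_strategy_def isolating_strategy_def)
  moreover have "\<exists>i. isolated (flipped_graph G ?\<tau> x i) (x i)" if play: "runner_play G r ?\<tau> x" for x
  proof -
    obtain n where caught_at: "x (Suc n) \<in> cop_position \<sigma> (x \<circ> Suc) n"
      using robber_play_if_runner_play[OF play] caught by fastforce
    moreover have "x (Suc n) \<in> pverts G"
      using caught_at \<sigma> by (auto simp: cop_strategy_def cop_position_def)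
    ultimately have "isolated (flipped_graph G ?\<tau> x (Suc n)) (x (Suc n))"
      unfolding flipped_graph_isolating_strategy by (intro isolated_isolate)
    then show ?thesis ..
  qed
  ultimately show ?thesis unfolding flipper_wins_def by blast
qed

lemma
  shows cop_width_pos: "1 \<le> cop_width r G"
    and cops_win_cop_width: "cops_win G r (cop_width r G)"
proof -
  let ?k = "card (pverts G) + 1"
  have "cop_strategy G ?k (\<lambda>_. pverts G)" by (simp add: cop_strategy_def)
  then have "cops_win G r ?k"
    unfolding cops_win_def by (auto simp: robber_play_def cop_position_def)
  then have "1 \<le> ?k \<and> cops_win G r ?k" by simp
  then have "1 \<le> cop_width r G \<and> cops_win G r (cop_width r G)"
    unfolding cop_width_def by (rule LeastI)
  then show "1 \<le> cop_width r G" "cops_win G r (cop_width r G)" by auto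
qed

lemma cops_win_mono: "cops_win G r k \<Longrightarrow> k \<le> k' \<Longrightarrow> cops_win G r k'"
  unfolding cops_win_def cop_strategy_def using order_trans by blast

lemma flip_width_le_cop_width:
  assumes "pair_graph G" and d: "cop_width 2 G \<le> d"
  shows "flip_width r G \<le> (3 + 2 * 2 ^ d) * cop_width r G"
proof -
  interpret pair_graph G by fact
  let ?k = "cop_width r G"
  have "flipper_wins G r ((3 + 2 * 2 ^ d) * ?k)"
  proof (rule flipper_wins_if_k_flip_isolate[OF cops_win_cop_width])
    fix C assume C: "C \<subseteq> pverts G" "card C \<le> ?k"
    have "card C + 2 * (2 ^ d * card C + 1) \<le> ?k + 2 * (2 ^ d * ?k + ?k)"
      using C(2) cop_width_pos by (intro add_mono mult_le_mono) auto
    also have "\<dots> = (3 + 2 * 2 ^ d) * ?k" by (simp add: algebra_simps)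
    finally show "k_flip ((3 + 2 * 2 ^ d) * ?k) G (isolate C G)"
      using cops_win_mono[OF cops_win_cop_width d] C(1) by (intro k_flip_isolate) auto
  qed
  then show ?thesis
    unfolding flip_width_def using cop_width_pos[of r G] by (intro Least_le) simp
qed

theorem theorem4:
  fixes \<G> :: "'a pair_pre_digraph set"
  assumes "graph_class \<G>"
    and "linear_cop_width \<G>"
  shows "linear_flip_width \<G>"
proof -
  obtain c :: real where cop_width_le: "\<And>r G. r \<ge> 1 \<Longrightarrow> G \<in> \<G> \<Longrightarrow> real (cop_width r G) \<le> c * real r"
    using assms(2) unfolding linear_cop_width_def by blast
  define d where "d = nat \<lfloor>c * 2\<rfloor>"
  have "real (flip_width r G) \<le> (3 + 2 * 2 ^ d) * c * real r" if "1 \<le> r" "G \<in> \<G>" for r G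
  proof -
    have "pair_graph G" using assms(1) that(2) by (simp add: graph_class_def)
    moreover have "cop_width 2 G \<le> d"
      using cop_width_le[of 2 G] that(2) unfolding d_def by (simp add: le_nat_floor)
    ultimately have "real (flip_width r G) \<le> real ((3 + 2 * 2 ^ d) * cop_width r G)"
      by (intro of_nat_mono flip_width_le_cop_width)
    also have "\<dots> = (3 + 2 * 2 ^ d) * real (cop_width r G)" by simp
    also have "\<dots> \<le> (3 + 2 * 2 ^ d) * (c * real r)"
      using cop_width_le[OF that] by (intro mult_left_mono) auto
    finally show ?thesis by (simp add: mult.assoc)
  qed
  then show ?thesis unfolding linear_flip_width_def by blast
qed

end
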